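(* In the setting of the context, let $\lambda_0,\lambda_1>0$ and let $N\ge1$ be an integer. For every truncated stopping rule $\psi\in\mathscr F^N$, $$L_N(\psi)\ge\bar c_1+\bar V_1^N(1).\qquad(1)$$ There is equality in (1) if $\psi\in\mathscr F^N$ satisfies the following condition $\mathfrak S_N(\psi)$: for all $1\le k<N$ and all $n\in\mathcal P_k$, $$\psi_n\simeq I_{\{g(z_n)\preccurlyeq\bar c_{k+1}+\bar V_{k+1}^N(z_n)\}}\quad P_0\text{-almost surely on }T_n^\psi.$$ Conversely, if there is equality in (1) for some $\psi\in\mathscr F^N$, then $\psi$ satisfies condition $\mathfrak S_N(\psi)$.
   Context: Setting. Observations arrive in groups $k=1,2,\dots$ of random sizes $\nu_1,\nu_2,\dots$, which are independent with values in $\mathscr G\subset\{0,1,2,\dots\}$ and known p.m.f.s $p_k(m)=P(\nu_k=m)$, $m\in\mathscr G$. For $n=(n_1,\dots,n_k)\in\mathscr G^k$ put $p(n)=\prod_{i=1}^kp_i(n_i)$, and $\mathcal P_k=\{n\in\mathscr G^k:p(n)>0\}$. Given the group sizes, all observations $X_{ij}$ ($j\le n_i$, $i\le k$) are i.i.d. with values in a measurable space $(\mathfrak X,\mathscr X)$ and density $f_\theta$ with respect to a $\sigma$-finite measure $\mu$, $\theta\in\{\theta_0,\theta_1\}$. Thus, given sizes $n$, the data $X^{(n)}=(X_1^{(n_1)},\dots,X_k^{(n_k)})$, $X_i^{(n_i)}=(X_{i1},\dots,X_{in_i})$, has density $f_\theta^{(n)}(x^{(n)})=\prod_{i=1}^k\prod_{j=1}^{n_i}f_\theta(x_{ij})$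 with respect to $\mu^n=\mu^{n_1}\otimes\cdots\otimes\mu^{n_k}$ on $\mathfrak X^n=\mathfrak X^{n_1}\times\cdots\times\mathfrak X^{n_k}$ (empty products are $1$; $\mathfrak X^0$ is a one-point space and $\mu^0$ a probability measure on it). For a function $F_n$ on $\mathfrak X^n$, $E_\theta F_n=\int F_nf_\theta^{(n)}d\mu^n$. Write $f_i,E_i,P_i$ for $f_{\theta_i},E_{\theta_i},P_{\theta_i}$, $i=0,1$. It is assumed that $\mu\{x:f_0(x)\ne f_1(x)\}>0$. A stopping rule $\psi$ is a family of measurable functions $\psi_n:\mathfrak X^n\to[0,1]$, $n\in\mathscr G^k$, $k\ge1$. For $n=(n_1,\dots,n_k)$ let $t_n^\psi(x^{(n)})=\prod_{i=1}^{k-1}\bigl(1-\psi_{(n_1,\dots,n_i)}(x_1^{(n_1)},\dots,x_i^{(n_i)})\bigr)$ (equal to $1$ for $k=1$), $s_n^\psi=t_n^\psi\psi_n$, $T_n^\psi=\{x^{(n)}\in\mathfrak X^n:t_n^\psi(x^{(n)})>0\}$. The class of truncated stopping rules is $\mathscr F^N=\{\psi:(1-\psi_{(n_1)})(1-\psi_{(n_1,n_2)})\cdots(1-\psi_{(n_1,\dots,n_N)})\equiv0\text{ for all }(n_1,\dots,n_N)\in\mathscr G^N\}$. Costs: $c(m)>0$ for $m\in\mathscr G$; $c(n)=\sum_{i=1}^kc(n_i)$ for $n\in\mathscr G^k$; $\bar c_k=\sum_{m\in\mathscr G}p_k(m)c(m)$, assumed to satisfy $0<\bar c_k<\infty$ for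 all $k$. Likelihood ratio: $z_n=f_1^{(n)}(x^{(n)})/f_0^{(n)}(x^{(n)})$ if $f_0^{(n)}(x^{(n)})>0$, $z_n=\infty$ if $f_0^{(n)}(x^{(n)})=0<f_1^{(n)}(x^{(n)})$, and $z_n=0$ otherwise. Let $g(z)=\min\{\lambda_0,\lambda_1z\}$, $z\ge0$, and for $\psi\in\mathscr F^N$ $$L_N(\psi)=\sum_{k=1}^\infty\sum_{n\in\mathscr G^k}p(n)E_0s_n^\psi\bigl(c(n)+g(z_n)\bigr)=\sum_{k=1}^{N-1}\sum_{n\in\mathscr G^k}p(n)E_0s_n^\psi\bigl(c(n)+g(z_n)\bigr)+\sum_{n\in\mathscr G^N}p(n)E_0t_n^\psi\bigl(c(n)+g(z_n)\bigr).$$ Define on $z\ge0$: $V_N^N(z)=g(z)$ and, for $k=N,N-1,\dots,2$, $V_{k-1}^N(z)=\min\{g(z),\ \bar c_k+\sum_{m\in\mathscr G}p_k(m)E_0V_k^N(zz_m)\}$; $\bar V_k^N(z)=\sum_{m\in\mathscr G}p_k(m)E_0V_k^N(zz_m)$, $1\le k\le N$ (here $z_m$ is the likelihood ratio of a single group of size $m$). Notation: $\psi\simeq I_{\{F_1\preccurlyeq F_2\}}$ means $I_{\{F_1<F_2\}}\le\psi\le I_{\{F_1\le F_2\}}$. "$P_0$-almost surely on $T_n^\psi$" means for $\mu^n$-almost every $x^{(n)}\in T_n^\psi\cap\{f_0^{(n)}>0\}$. *)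

theory Defs
  imports "HOL-Probability.Probability"
begin

text \<open>
  Group sizes \<open>n = (n\<^sub>1,\<dots>,n\<^sub>k)\<close> are lists of length \<open>k\<close>. A point of \<open>\<XX>\<^sup>n\<close> is
  a function on the index set below; groups and positions inside a group are numbered from \<open>0\<close>
  there, so the observation \<open>X\<^sub>i\<^sub>j\<close> is \<open>x (i - 1, j - 1)\<close>. The first \<open>i\<close> groups
  of \<open>x\<close> are the restriction of \<open>x\<close> to the indices of \<open>take i n\<close>. The
  p.m.f.s \<open>p k\<close> keep their numbering \<open>k \<ge> 1\<close>, and \<open>p 0\<close> is never used.
\<close>

definition obs_index :: "nat list \<Rightarrow> (nat \<times> nat) set" where
  "obs_index n = (SIGMA i:{..<length n}. {..<n ! i})"

text \<open>
  All nonnegative quantities are \<^typ>\<open>ennreal\<close>-valued. Likelihood ratios may be infinite; then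
  \<open>g \<infinity> = \<lambda>\<^sub>0\<close>. The product \<open>z * z\<^sub>m\<close> with \<open>z\<^sub>m = \<infinity>\<close> occurs only where
  \<open>f\<^sub>0\<close> vanishes, and such points do not contribute to \<open>E\<^sub>0\<close>.
\<close>

locale grouped_test =
  fixes G :: "nat set"
    and p :: "nat \<Rightarrow> nat pmf"
    and c :: "nat \<Rightarrow> real"
    and M :: "'a measure"
    and f0 f1 :: "'a \<Rightarrow> real"
    and l0 l1 :: real
  assumes sigma_finite_M: "sigma_finite_measure M"
    and f0_measurable: "f0 \<in> borel_measurable M"
    and f1_measurable: "f1 \<in> borel_measurable M"
    and f0_nonneg: "\<And>x. x \<in> space M \<Longrightarrow> 0 \<le> f0 x"
    and f1_nonneg: "\<And>x. x \<in> space M \<Longrightarrow> 0 \<le> f1 x"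
    and f0_density: "(\<integral>\<^sup>+ x. ennreal (f0 x) \<partial>M) = 1"
    and f1_density: "(\<integral>\<^sup>+ x. ennreal (f1 x) \<partial>M) = 1"
    and f0_neq_f1: "0 < emeasure M {x \<in> space M. f0 x \<noteq> f1 x}"
    and p_values: "\<And>k. 1 \<le> k \<Longrightarrow> set_pmf (p k) \<subseteq> G"
    and cost_pos: "\<And>m. m \<in> G \<Longrightarrow> 0 < c m"
    and mean_cost_pos: "\<And>k. 1 \<le> k \<Longrightarrow>
      0 < (\<Sum>\<^sub>\<infinity>m\<in>G. ennreal (pmf (p k) m) * ennreal (c m))"
    and mean_cost_finite: "\<And>k. 1 \<le> k \<Longrightarrow>
      (\<Sum>\<^sub>\<infinity>m\<in>G. ennreal (pmf (p k) m) * ennreal (c m)) < \<infinity>"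
    and l0_pos: "0 < l0"
    and l1_pos: "0 < l1"
begin

definition sizes :: "nat \<Rightarrow> nat list set" where
  "sizes k = {n. length n = k \<and> set n \<subseteq> G}"

definition size_prob :: "nat list \<Rightarrow> real" where
  "size_prob n = (\<Prod>i<length n. pmf (p (Suc i)) (n ! i))"

definition pos_sizes :: "nat \<Rightarrow> nat list set" where
  "pos_sizes k = {n \<in> sizes k. 0 < size_prob n}"

definition total_cost :: "nat list \<Rightarrow> real" where
  "total_cost n = (\<Sum>i<length n. c (n ! i))"

definition mean_cost :: "nat \<Rightarrow> ennreal" where
  "mean_cost k = (\<Sum>\<^sub>\<infinity>m\<in>G. ennreal (pmf (p k) m) * ennreal (c m))"

definition data_measure :: "nat list \<Rightarrow> (nat \<times> nat \<Rightarrow> 'a) measure" where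
  "data_measure n = (\<Pi>\<^sub>M ij\<in>obs_index n. M)"

definition joint_density :: "('a \<Rightarrow> real) \<Rightarrow> nat list \<Rightarrow> (nat \<times> nat \<Rightarrow> 'a) \<Rightarrow> real" where
  "joint_density f n x = (\<Prod>i<length n. \<Prod>j<n ! i. f (x (i, j)))"

definition E0 :: "nat list \<Rightarrow> ((nat \<times> nat \<Rightarrow> 'a) \<Rightarrow> ennreal) \<Rightarrow> ennreal" where
  "E0 n F = (\<integral>\<^sup>+ x. F x * ennreal (joint_density f0 n x) \<partial>data_measure n)"

definition lik_ratio :: "nat list \<Rightarrow> (nat \<times> nat \<Rightarrow> 'a) \<Rightarrow> ennreal" where
  "lik_ratio n x =
     (if 0 < joint_density f0 n x then ennreal (joint_density f1 n x / joint_density f0 n x)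
      else if 0 < joint_density f1 n x then \<infinity> else 0)"

definition g :: "ennreal \<Rightarrow> ennreal" where
  "g z = min (ennreal l0) (ennreal l1 * z)"

definition stopping_rule :: "(nat list \<Rightarrow> (nat \<times> nat \<Rightarrow> 'a) \<Rightarrow> real) \<Rightarrow> bool" where
  "stopping_rule \<psi> \<longleftrightarrow>
     (\<forall>k\<ge>1. \<forall>n\<in>sizes k. \<psi> n \<in> borel_measurable (data_measure n) \<and>
        (\<forall>x\<in>space (data_measure n). 0 \<le> \<psi> n x \<and> \<psi> n x \<le> 1))"

definition stop_first :: "(nat list \<Rightarrow> (nat \<times> nat \<Rightarrow> 'a) \<Rightarrow> real) \<Rightarrow>
    nat list \<Rightarrow> (nat \<times> nat \<Rightarrow> 'a) \<Rightarrow> nat \<Rightarrow> real" where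
  "stop_first \<psi> n x i = \<psi> (take i n) (restrict x (obs_index (take i n)))"

definition reach :: "(nat list \<Rightarrow> (nat \<times> nat \<Rightarrow> 'a) \<Rightarrow> real) \<Rightarrow>
    nat list \<Rightarrow> (nat \<times> nat \<Rightarrow> 'a) \<Rightarrow> real" where
  "reach \<psi> n x = (\<Prod>i\<in>{1..<length n}. 1 - stop_first \<psi> n x i)"

definition stop_at :: "(nat list \<Rightarrow> (nat \<times> nat \<Rightarrow> 'a) \<Rightarrow> real) \<Rightarrow>
    nat list \<Rightarrow> (nat \<times> nat \<Rightarrow> 'a) \<Rightarrow> real" where
  "stop_at \<psi> n x = reach \<psi> n x * \<psi> n x"

definition reach_set :: "(nat list \<Rightarrow> (nat \<times> nat \<Rightarrow> 'a) \<Rightarrow> real) \<Rightarrow>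
    nat list \<Rightarrow> (nat \<times> nat \<Rightarrow> 'a) set" where
  "reach_set \<psi> n = {x \<in> space (data_measure n). 0 < reach \<psi> n x}"

definition truncated_rules :: "nat \<Rightarrow> (nat list \<Rightarrow> (nat \<times> nat \<Rightarrow> 'a) \<Rightarrow> real) set" where
  "truncated_rules N = {\<psi>. stopping_rule \<psi> \<and>
     (\<forall>n\<in>sizes N. \<forall>x\<in>space (data_measure n). (\<Prod>i\<in>{1..N}. 1 - stop_first \<psi> n x i) = 0)}"

text \<open>
  On \<^term>\<open>truncated_rules N\<close> the series below is \<open>L\<^sub>N\<close>: its terms vanish for \<open>k > N\<close>.
\<close>

definition L :: "(nat list \<Rightarrow> (nat \<times> nat \<Rightarrow> 'a) \<Rightarrow> real) \<Rightarrow> ennreal" where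
  "L \<psi> = (\<Sum>\<^sub>\<infinity>k\<in>{1..}. \<Sum>\<^sub>\<infinity>n\<in>sizes k. ennreal (size_prob n) *
     E0 n (\<lambda>x. ennreal (stop_at \<psi> n x) * (ennreal (total_cost n) + g (lik_ratio n x))))"

definition group_mean :: "nat \<Rightarrow> (ennreal \<Rightarrow> ennreal) \<Rightarrow> ennreal \<Rightarrow> ennreal" where
  "group_mean k h z =
     (\<Sum>\<^sub>\<infinity>m\<in>G. ennreal (pmf (p k) m) * E0 [m] (\<lambda>x. h (z * lik_ratio [m] x)))"

function V :: "nat \<Rightarrow> nat \<Rightarrow> ennreal \<Rightarrow> ennreal" where
  "V N k = (if k < N
     then (\<lambda>z. min (g z) (mean_cost (Suc k) + group_mean (Suc k) (V N (Suc k)) z))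
     else g)"
  by auto
termination by (relation "Wellfounded.measure (\<lambda>(N, k). N - k)") auto

declare V.simps [simp del]

definition Vbar :: "nat \<Rightarrow> nat \<Rightarrow> ennreal \<Rightarrow> ennreal" where
  "Vbar N k z = group_mean k (V N k) z"

text \<open>
  \<open>y \<simeq> I\<^bsub>{a \<preccurlyeq> b}\<^esub>\<close> at a single point.
\<close>

definition approx_indicator :: "real \<Rightarrow> ennreal \<Rightarrow> ennreal \<Rightarrow> bool" where
  "approx_indicator y a b \<longleftrightarrow> of_bool (a < b) \<le> y \<and> y \<le> of_bool (a \<le> b)"

definition optimality_cond :: "nat \<Rightarrow> (nat list \<Rightarrow> (nat \<times> nat \<Rightarrow> 'a) \<Rightarrow> real) \<Rightarrow> bool" where
  "optimality_cond N \<psi> \<longleftrightarrow>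
     (\<forall>k. 1 \<le> k \<and> k < N \<longrightarrow> (\<forall>n\<in>pos_sizes k.
        AE x in data_measure n. x \<in> reach_set \<psi> n \<and> 0 < joint_density f0 n x \<longrightarrow>
          approx_indicator (\<psi> n x) (g (lik_ratio n x))
            (mean_cost (Suc k) + Vbar N (Suc k) (lik_ratio n x))))"

end

end

theory Submission
  imports Defs
begin

text \<open>
  Backward induction. Replacing the decisions of \<open>\<psi>\<close> from stage \<open>k\<close> on by the optimal
  continuation gives a cost \<open>Q k\<close> with \<open>Q N = L\<^sub>N(\<psi>)\<close> and \<open>Q 1\<close> the lower bound. Integrating
  out group \<open>k + 1\<close> by Tonelli, where the likelihood ratio is multiplicative, shows that
  \<open>Q (k + 1) - Q k\<close> integrates the excess of the mixture
  \<open>\<psi> g + (1 - \<psi>) (mean cost + Vbar)\<close> over the minimum of its two parts on the set where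
  \<open>\<psi>\<close> has not stopped. This excess is nonnegative, and since all costs are finite its integral
  vanishes exactly when \<open>\<psi>\<close> takes the cheaper alternative almost surely.
\<close>

section \<open>Sums and integrals with values in the extended nonnegative reals\<close>

text \<open>For nonnegative terms \<open>infsum\<close> is the supremum of the finite partial sums,
  each of which is the integral of a truncation. Once sums over countable types are integrals,
  linearity, Tonelli and the equality case of monotonicity carry over to them.\<close>

lemma infsum_ennreal_eq_nn_integral:
  fixes f :: "'b::countable \<Rightarrow> ennreal"
  shows "infsum f A = (\<integral>\<^sup>+x. f x \<partial>count_space A)"
proof (rule antisym)
  have "sum f F \<le> (\<integral>\<^sup>+x. f x \<partial>count_space A)" if "finite F" "F \<subseteq> A" for F
  proof -
    have "sum f F = (\<integral>\<^sup>+x. f x * indicator F x \<partial>count_space A)"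
      using that by (subst nn_integral_count_space'[of F])
        (auto intro!: sum.cong split: split_indicator)
    also have "\<dots> \<le> (\<integral>\<^sup>+x. f x \<partial>count_space A)"
      by (intro nn_integral_mono) (auto split: split_indicator)
    finally show ?thesis .
  qed
  then show "infsum f A \<le> (\<integral>\<^sup>+x. f x \<partial>count_space A)"
    by (subst nonneg_infsum_complete) (auto intro!: SUP_least)
next
  \<comment> \<open>The enumeration \<open>to_nat\<close> exhausts \<open>A\<close> by an increasing
    sequence of finite sets, so monotone convergence applies although the supremum in
    \<open>infsum\<close> runs over a directed family.\<close>
  define B where "B n = {a \<in> A. to_nat a < n}" for n
  have finB: "finite (B n)" for n
    by (rule finite_subset[of _ "to_nat -` {..<n}"])
      (auto simp: B_def intro!: finite_vimageI)
  have *: "f x = (SUP n. f x * indicator (B n) x)" if "x \<in> A" for x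
    using that
    by (intro antisym SUP_upper2[of "Suc (to_nat x)"] SUP_least)
      (auto simp: B_def split: split_indicator)
  have "(\<integral>\<^sup>+x. f x \<partial>count_space A) = (\<integral>\<^sup>+x. (SUP n. f x * indicator (B n) x) \<partial>count_space A)"
    using * by (intro nn_integral_cong) simp
  also have "\<dots> = (SUP n. (\<integral>\<^sup>+x. f x * indicator (B n) x \<partial>count_space A))"
    by (intro nn_integral_monotone_convergence_SUP)
      (auto simp: incseq_def le_fun_def B_def split: split_indicator)
  also have "\<dots> \<le> infsum f A"
  proof (rule SUP_least)
    fix n
    have "(\<integral>\<^sup>+x. f x * indicator (B n) x \<partial>count_space A) = sum f (B n)"
      using finB by (subst nn_integral_count_space'[of "B n"])
        (auto simp: B_def intro!: sum.cong split: split_indicator)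
    also have "\<dots> \<le> infsum f A"
      using finB by (subst nonneg_infsum_complete) (auto intro!: SUP_upper simp: B_def)
    finally show "(\<integral>\<^sup>+x. f x * indicator (B n) x \<partial>count_space A) \<le> infsum f A" .
  qed
  finally show "(\<integral>\<^sup>+x. f x \<partial>count_space A) \<le> infsum f A" .
qed

lemma infsum_ennreal_cmult:
  fixes f :: "'b::countable \<Rightarrow> ennreal"
  shows "infsum (\<lambda>x. a * f x) A = a * infsum f A"
  by (simp add: infsum_ennreal_eq_nn_integral nn_integral_cmult)

lemma infsum_ennreal_add:
  fixes f :: "'b::countable \<Rightarrow> ennreal"
  shows "infsum (\<lambda>x. f x + h x) A = infsum f A + infsum h A"
  by (simp add: infsum_ennreal_eq_nn_integral nn_integral_add)

lemma infsum_ennreal_mono: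
  fixes f :: "'b::countable \<Rightarrow> ennreal"
  assumes "\<And>x. x \<in> A \<Longrightarrow> f x \<le> h x"
  shows "infsum f A \<le> infsum h A"
  using assms by (auto simp: infsum_ennreal_eq_nn_integral intro!: nn_integral_mono)

text \<open>A strict inequality in one term makes the total strictly larger as long as the smaller
  total is finite; an infinite total could absorb it. Almost everywhere for counting measure means
  everywhere on \<open>A\<close>.\<close>

lemma infsum_ennreal_mono_eq_iff:
  fixes f :: "'b::countable \<Rightarrow> ennreal"
  assumes le: "\<And>x. x \<in> A \<Longrightarrow> f x \<le> h x" and fin: "infsum f A \<noteq> \<infinity>"
  shows "infsum f A = infsum h A \<longleftrightarrow> (\<forall>x\<in>A. f x = h x)"
proof
  assume "infsum f A = infsum h A"
  then have "\<not> (\<integral>\<^sup>+x. f x \<partial>count_space A) < (\<integral>\<^sup>+x. h x \<partial>count_space A)"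
    by (simp add: infsum_ennreal_eq_nn_integral)
  then have "AE x in count_space A. h x \<le> f x"
    using nn_integral_less[of f "count_space A" h] le fin
    by (auto simp: infsum_ennreal_eq_nn_integral AE_count_space)
  then show "\<forall>x\<in>A. f x = h x"
    using le by (auto simp: AE_count_space intro: antisym)
qed (auto intro: infsum_cong)

lemma le_infsum_ennreal:
  fixes f :: "'b::countable \<Rightarrow> ennreal"
  assumes "x \<in> A"
  shows "f x \<le> infsum f A"
proof -
  have "f x = sum f {x}" by simp
  also have "\<dots> \<le> infsum f A"
    using assms by (subst nonneg_infsum_complete) (auto intro!: SUP_upper2[of "{x}"])
  finally show ?thesis .
qed

lemma infsum_ennreal_Sigma:
  fixes f :: "'b::countable \<Rightarrow> 'd::countable \<Rightarrow> ennreal"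
  shows "infsum (\<lambda>x. infsum (f x) B) A = infsum (\<lambda>(x, y). f x y) (A \<times> B)"
proof -
  \<comment> \<open>Both index sets are turned into indicators, because the iterated-integral rule
    for counting measures is stated on the whole types.\<close>
  have "infsum (\<lambda>(x, y). f x y) (A \<times> B)
      = (\<integral>\<^sup>+z. (case z of (x, y) \<Rightarrow> f x y * indicator A x * indicator B y) \<partial>count_space UNIV)"
    by (subst infsum_ennreal_eq_nn_integral, subst nn_integral_count_space_indicator)
      (auto intro!: nn_integral_cong split: split_indicator)
  also have "\<dots> = (\<integral>\<^sup>+x. \<integral>\<^sup>+y. f x y * indicator A x * indicator B y \<partial>count_space UNIV \<partial>count_space UNIV)"
    by (subst nn_integral_fst_count_space[symmetric]) simp
  also have "\<dots> = (\<integral>\<^sup>+x. (\<integral>\<^sup>+y. f x y * indicator B y \<partial>count_space UNIV) * indicator A x \<partial>count_space UNIV)"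
    by (intro nn_integral_cong) (auto split: split_indicator)
  also have "\<dots> = (\<integral>\<^sup>+x. infsum (f x) B * indicator A x \<partial>count_space UNIV)"
    by (simp add: infsum_ennreal_eq_nn_integral nn_integral_restrict_space[symmetric]
        restrict_count_space)
  also have "\<dots> = infsum (\<lambda>x. infsum (f x) B) A"
    by (simp add: infsum_ennreal_eq_nn_integral[of _ A] nn_integral_restrict_space[symmetric]
        restrict_count_space)
  finally show ?thesis ..
qed

lemma infsum_ennreal_nn_integral:
  fixes f :: "'b::countable \<Rightarrow> 'd \<Rightarrow> ennreal"
  assumes "\<And>i. i \<in> A \<Longrightarrow> f i \<in> borel_measurable M"
  shows "(\<integral>\<^sup>+x. infsum (\<lambda>i. f i x) A \<partial>M) = infsum (\<lambda>i. \<integral>\<^sup>+x. f i x \<partial>M) A"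
  using assms by (simp add: infsum_ennreal_eq_nn_integral nn_integral_count_space_nn_integral)

lemma borel_measurable_infsum_ennreal:
  fixes f :: "'b::countable \<Rightarrow> 'd \<Rightarrow> ennreal"
  assumes [measurable]: "\<And>i. i \<in> A \<Longrightarrow> f i \<in> borel_measurable M"
  shows "(\<lambda>x. infsum (\<lambda>i. f i x) A) \<in> borel_measurable M"
proof -
  have "(\<lambda>x. \<integral>\<^sup>+i. f i x \<partial>count_space A) \<in> borel_measurable M"
  proof (rule sigma_finite_measure.borel_measurable_nn_integral)
    show "sigma_finite_measure (count_space A)"
      by (rule sigma_finite_measure_count_space_countable) simp
    show "(\<lambda>(x, i). f i x) \<in> borel_measurable (M \<Otimes>\<^sub>M count_space A)"
      unfolding split_beta' by (rule measurable_compose_countable'[of A]) auto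
  qed
  then show ?thesis by (simp add: infsum_ennreal_eq_nn_integral)
qed

lemma nn_integral_mono_eq_iff:
  assumes [measurable]: "f \<in> borel_measurable M" "h \<in> borel_measurable M"
    and le: "\<And>x. x \<in> space M \<Longrightarrow> f x \<le> h x" and fin: "(\<integral>\<^sup>+x. f x \<partial>M) \<noteq> \<infinity>"
  shows "(\<integral>\<^sup>+x. f x \<partial>M) = (\<integral>\<^sup>+x. h x \<partial>M) \<longleftrightarrow> (AE x in M. f x = h x)"
proof
  assume "(\<integral>\<^sup>+x. f x \<partial>M) = (\<integral>\<^sup>+x. h x \<partial>M)"
  then have "AE x in M. h x \<le> f x"
    using nn_integral_less[of f M h] le fin by (auto intro: AE_I2)
  with AE_space show "AE x in M. f x = h x"
    by eventually_elim (auto intro: antisym le)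
qed (rule nn_integral_cong_AE)

section \<open>Pointwise comparison of stopping and continuing\<close>

text \<open>Here \<open>r\<close> is the weight of reaching the stage, \<open>y\<close> the
  probability of stopping, \<open>C\<close> the cost paid so far, \<open>a\<close> the loss on
  stopping and \<open>b\<close> the cost of going on. The excess of the right side is
  \<open>r\<close> times \<open>y * (a - min a b) + (1 - y) * (b - min a b)\<close>; finiteness of
  \<open>a\<close> and \<open>b\<close> allows this computation in the reals.\<close>

lemma mixture_ge_min:
  fixes a b :: ennreal and C r y :: real
  assumes "0 \<le> C" "0 \<le> r" "0 \<le> y" "y \<le> 1" "a < \<infinity>" "b < \<infinity>"
  shows "ennreal r * (ennreal C + min a b)
      \<le> ennreal (r * y) * (ennreal C + a) + ennreal (r * (1 - y)) * (ennreal C + b)"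
    and "ennreal r * (ennreal C + min a b)
        = ennreal (r * y) * (ennreal C + a) + ennreal (r * (1 - y)) * (ennreal C + b)
      \<longleftrightarrow> r = 0 \<or> of_bool (a < b) \<le> y \<and> y \<le> of_bool (a \<le> b)"
proof -
  obtain a' where a: "a = ennreal a'" "0 \<le> a'" using assms(5) by (cases a) auto
  obtain b' where b: "b = ennreal b'" "0 \<le> b'" using assms(6) by (cases b) auto
  have min_eq: "min a b = ennreal (min a' b')"
    using a b by (auto simp: min_def)
  have lhs: "ennreal r * (ennreal C + min a b) = ennreal (r * (C + min a' b'))"
    using assms a b by (simp add: min_eq[unfolded a(1) b(1)] ennreal_mult)
  have rhs: "ennreal (r * y) * (ennreal C + a) + ennreal (r * (1 - y)) * (ennreal C + b)
      = ennreal (r * (y * (C + a') + (1 - y) * (C + b')))"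
    using assms a b
    by (simp add: distrib_left mult.assoc flip: ennreal_plus ennreal_mult)
  have diff: "y * (C + a') + (1 - y) * (C + b') - (C + min a' b')
      = y * (a' - min a' b') + (1 - y) * (b' - min a' b')"
    by (simp add: algebra_simps)
  have nn: "0 \<le> y * (a' - min a' b')" "0 \<le> (1 - y) * (b' - min a' b')"
    using assms by auto
  have "0 \<le> y * (C + a') + (1 - y) * (C + b') - (C + min a' b')"
    unfolding diff using nn by (rule add_nonneg_nonneg)
  then have le: "r * (C + min a' b') \<le> r * (y * (C + a') + (1 - y) * (C + b'))"
    using assms(2) by (intro mult_left_mono) auto
  show "ennreal r * (ennreal C + min a b)
      \<le> ennreal (r * y) * (ennreal C + a) + ennreal (r * (1 - y)) * (ennreal C + b)"
    unfolding lhs rhs using le by (rule ennreal_leI)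
  have "ennreal r * (ennreal C + min a b)
        = ennreal (r * y) * (ennreal C + a) + ennreal (r * (1 - y)) * (ennreal C + b)
     \<longleftrightarrow> r * (C + min a' b') = r * (y * (C + a') + (1 - y) * (C + b'))"
    unfolding lhs rhs using assms a b by (intro ennreal_inj) auto
  also have "\<dots> \<longleftrightarrow> r = 0 \<or> y * (a' - min a' b') + (1 - y) * (b' - min a' b') = 0"
    using diff by auto
  also have "\<dots> \<longleftrightarrow> r = 0 \<or> y * (a' - min a' b') = 0 \<and> (1 - y) * (b' - min a' b') = 0"
    using nn by (simp add: add_nonneg_eq_0_iff)
  \<comment> \<open>If \<open>a' < b'\<close> the second product forces \<open>y = 1\<close>, if
    \<open>a' > b'\<close> the first forces \<open>y = 0\<close>, and a tie leaves \<open>y\<close>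
    free in the unit interval.\<close>
  also have "\<dots> \<longleftrightarrow> r = 0 \<or> of_bool (a' < b') \<le> y \<and> y \<le> of_bool (a' \<le> b')"
    using assms(3,4) by (cases a' b' rule: linorder_cases) auto
  finally show "ennreal r * (ennreal C + min a b)
        = ennreal (r * y) * (ennreal C + a) + ennreal (r * (1 - y)) * (ennreal C + b)
      \<longleftrightarrow> r = 0 \<or> of_bool (a < b) \<le> y \<and> y \<le> of_bool (a \<le> b)"
    using a b by (simp add: ennreal_less_iff)
qed

section \<open>Adjoining a group of observations\<close>

lemma finite_obs_index [simp]: "finite (obs_index n)"
  by (simp add: obs_index_def)

lemma obs_index_append:
  "obs_index (n @ [m]) = obs_index n \<union> (\<lambda>ij. (length n, snd ij)) ` obs_index [m]"
  by (auto simp: obs_index_def nth_append less_Suc_eq image_iff split: if_splits)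

lemma obs_index_take: "obs_index (take i n) \<subseteq> obs_index n"
  by (auto simp: obs_index_def)

text \<open>
  The added group is number \<open>length n\<close> in the longer sample but number \<open>0\<close> in its own sample space.
\<close>

definition append_obs :: "nat list \<Rightarrow> nat \<Rightarrow> (nat \<times> nat \<Rightarrow> 'a) \<times> (nat \<times> nat \<Rightarrow> 'a) \<Rightarrow> nat \<times> nat \<Rightarrow> 'a" where
  "append_obs n m z = (\<lambda>ij\<in>obs_index (n @ [m]).
     if fst ij < length n then fst z ij else snd z (0, snd ij))"

context grouped_test
begin

interpretation data: product_sigma_finite "\<lambda>_. M"
  using sigma_finite_M by (simp add: product_sigma_finite_def)

lemma sigma_finite_data_measure: "sigma_finite_measure (data_measure n)"
  unfolding data_measure_def by (rule data.sigma_finite) simp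

lemma measurable_append_obs [measurable]:
  "append_obs n m \<in> data_measure n \<Otimes>\<^sub>M data_measure [m] \<rightarrow>\<^sub>M data_measure (n @ [m])"
  unfolding append_obs_def data_measure_def
proof (rule measurable_restrict)
  fix ij assume ij: "ij \<in> obs_index (n @ [m])"
  show "(\<lambda>z. if fst ij < length n then fst z ij else snd z (0, snd ij))
      \<in> Pi\<^sub>M (obs_index n) (\<lambda>_. M) \<Otimes>\<^sub>M Pi\<^sub>M (obs_index [m]) (\<lambda>_. M) \<rightarrow>\<^sub>M M"
  proof (cases "fst ij < length n")
    case True
    then have "ij \<in> obs_index n" using ij by (auto simp: obs_index_append)
    then show ?thesis using True by simp
  next
    case False
    then have "(0, snd ij) \<in> obs_index [m]" using ij by (auto simp: obs_index_def nth_append less_Suc_eq)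
    then show ?thesis using False by simp
  qed
qed

text \<open>A product measure is determined by its values on boxes. The preimage of a box is a
  product of two boxes, one for the old groups and one for the new, and the masses multiply. This
  turns integrals over the longer sample into iterated integrals.\<close>

lemma distr_append_obs:
  "distr (data_measure n \<Otimes>\<^sub>M data_measure [m]) (data_measure (n @ [m])) (append_obs n m)
    = data_measure (n @ [m])"
proof -
  interpret D: sigma_finite_measure "data_measure [m]" by (rule sigma_finite_data_measure)
  let ?P = "data_measure n \<Otimes>\<^sub>M data_measure [m]"
  have "distr ?P (data_measure (n @ [m])) (append_obs n m) = PiM (obs_index (n @ [m])) (\<lambda>_. M)"
  proof (rule data.PiM_eqI)
    fix A :: "nat \<times> nat \<Rightarrow> 'a set" assume A: "\<And>i. i \<in> obs_index (n @ [m]) \<Longrightarrow> A i \<in> sets M"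
    \<comment> \<open>Position \<open>j\<close> of the separate group, indexed
      \<open>(0, j)\<close>, moves to its place \<open>(length n, j)\<close> in the longer
      sample.\<close>
    let ?h = "\<lambda>ij. (length n, snd ij) :: nat \<times> nat"
    have A1: "A i \<in> sets M" if "i \<in> obs_index n" for i
      using that by (intro A) (auto simp: obs_index_append)
    have A2: "A (?h i) \<in> sets M" if "i \<in> obs_index [m]" for i
      using that by (intro A) (auto simp: obs_index_append)
    have lt: "fst ij < length n" if "ij \<in> obs_index n" for ij
      using that by (auto simp: obs_index_def)
    have z: "(0, snd ij) = ij" if "ij \<in> obs_index [m]" for ij
      using that by (cases ij) (auto simp: obs_index_def)
    have "append_obs n m -` PiE (obs_index (n @ [m])) A \<inter> space ?P
        = PiE (obs_index n) A \<times> PiE (obs_index [m]) (\<lambda>ij. A (?h ij))" (is "?l = ?r")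
    proof (intro set_eqI iffI)
      fix xw assume xw: "xw \<in> ?l"
      obtain x w where [simp]: "xw = (x, w)" by (cases xw)
      have sp: "x \<in> space (data_measure n)" "w \<in> space (data_measure [m])"
        using xw by (auto simp: space_pair_measure)
      have val: "append_obs n m (x, w) ij \<in> A ij" if "ij \<in> obs_index (n @ [m])" for ij
        using xw that by auto
      have "x ij \<in> A ij" if "ij \<in> obs_index n" for ij
        using val[of ij] that lt[OF that] by (simp add: append_obs_def obs_index_append)
      moreover have "w ij \<in> A (?h ij)" if "ij \<in> obs_index [m]" for ij
        using val[of "?h ij"] that z[OF that] by (auto simp: append_obs_def obs_index_append)
      ultimately show "xw \<in> ?r"
        using sp by (auto simp: data_measure_def space_PiM PiE_iff)
    next
      fix xw assume xw: "xw \<in> ?r"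
      obtain x w where [simp]: "xw = (x, w)" by (cases xw)
      have "x \<in> space (data_measure n)" "w \<in> space (data_measure [m])"
        using xw A1[THEN sets.sets_into_space] A2[THEN sets.sets_into_space]
        by (fastforce simp: data_measure_def space_PiM PiE_iff)+
      moreover have "append_obs n m (x, w) ij \<in> A ij" if ij: "ij \<in> obs_index (n @ [m])" for ij
      proof (cases "ij \<in> obs_index n")
        case True
        then show ?thesis using xw ij lt[OF True] by (auto simp: append_obs_def)
      next
        case False
        then obtain kl where "kl \<in> obs_index [m]" "ij = ?h kl" using ij unfolding obs_index_append by blast
        then show ?thesis using xw that z by (auto simp: append_obs_def)
      qed
      ultimately show "xw \<in> ?l"
        by (auto simp: space_pair_measure PiE_iff append_obs_def)
    qed
    then have "emeasure (distr ?P (data_measure (n @ [m])) (append_obs n m)) (PiE (obs_index (n @ [m])) A)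
        = emeasure ?P (PiE (obs_index n) A \<times> PiE (obs_index [m]) (\<lambda>ij. A (?h ij)))"
      using A by (subst emeasure_distr[OF measurable_append_obs])
        (auto simp: data_measure_def intro!: sets_PiM_I_finite)
    also have "\<dots> = emeasure (data_measure n) (PiE (obs_index n) A)
        * emeasure (data_measure [m]) (PiE (obs_index [m]) (\<lambda>ij. A (?h ij)))"
      using A1 A2
      by (intro D.emeasure_pair_measure_Times) (auto simp: data_measure_def intro!: sets_PiM_I_finite)
    also have "\<dots> = (\<Prod>i\<in>obs_index n. emeasure M (A i)) * (\<Prod>i\<in>obs_index [m]. emeasure M (A (?h i)))"
      using A1 A2 unfolding data_measure_def by (simp add: data.emeasure_PiM)
    also have "\<dots> = (\<Prod>i\<in>obs_index (n @ [m]). emeasure M (A i))"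
    proof -
      \<comment> \<open>The old indices and the relabelled new ones are disjoint blocks, so the
        product over all indices splits.\<close>
      have "inj_on ?h (obs_index [m])" by (auto simp: inj_on_def obs_index_def)
      moreover have "obs_index n \<inter> ?h ` obs_index [m] = {}" using lt by fastforce
      ultimately show ?thesis
        unfolding obs_index_append by (subst prod.union_disjoint) (simp_all add: prod.reindex o_def)
    qed
    finally show "emeasure (distr ?P (data_measure (n @ [m])) (append_obs n m)) (PiE (obs_index (n @ [m])) A)
        = (\<Prod>i\<in>obs_index (n @ [m]). emeasure M (A i))" .
  qed (auto simp: data_measure_def)
  then show ?thesis by (simp add: data_measure_def)
qed

section \<open>Densities, likelihood ratios and decisions on the enlarged sample\<close>

lemma joint_density_append_obs:
  "joint_density f (n @ [m]) (append_obs n m (x, w)) = joint_density f n x * joint_density f [m] w"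
proof -
  have "joint_density f (n @ [m]) (append_obs n m (x, w))
      = (\<Prod>i<length n. \<Prod>j<n ! i. f (append_obs n m (x, w) (i, j)))
        * (\<Prod>j<m. f (append_obs n m (x, w) (length n, j)))"
    by (simp add: joint_density_def nth_append)
  also have "(\<Prod>i<length n. \<Prod>j<n ! i. f (append_obs n m (x, w) (i, j))) = joint_density f n x"
    unfolding joint_density_def
    by (intro prod.cong) (auto simp: append_obs_def obs_index_def nth_append)
  also have "(\<Prod>j<m. f (append_obs n m (x, w) (length n, j))) = joint_density f [m] w"
    by (auto simp: joint_density_def append_obs_def obs_index_def nth_append intro!: prod.cong)
  finally show ?thesis .
qed

lemma measurable_joint_density [measurable]:
  assumes [measurable]: "f \<in> borel_measurable M"
  shows "joint_density f n \<in> borel_measurable (data_measure n)"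
  unfolding joint_density_def data_measure_def
proof (intro borel_measurable_prod)
  fix i j assume "i \<in> {..<length n}" "j \<in> {..<n ! i}"
  then have "(i, j) \<in> obs_index n" by (auto simp: obs_index_def)
  then show "(\<lambda>x. f (x (i, j))) \<in> borel_measurable (Pi\<^sub>M (obs_index n) (\<lambda>_. M))"
    by measurable
qed

lemma joint_density_nonneg:
  assumes "\<And>x. x \<in> space M \<Longrightarrow> 0 \<le> f x" and "x \<in> space (data_measure n)"
  shows "0 \<le> joint_density f n x"
  using assms(2) unfolding joint_density_def
  by (intro prod_nonneg assms(1)) (auto simp: data_measure_def space_PiM PiE_iff obs_index_def)

lemmas [measurable] = f0_measurable f1_measurable

lemma joint_density_f0_nonneg: "x \<in> space (data_measure n) \<Longrightarrow> 0 \<le> joint_density f0 n x"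
  by (rule joint_density_nonneg[OF f0_nonneg])

lemma joint_density_f1_nonneg: "x \<in> space (data_measure n) \<Longrightarrow> 0 \<le> joint_density f1 n x"
  by (rule joint_density_nonneg[OF f1_nonneg])

lemma measurable_lik_ratio [measurable]: "lik_ratio n \<in> borel_measurable (data_measure n)"
  unfolding lik_ratio_def by measurable

text \<open>Positivity of the two null densities puts all three ratios in the first branch of
  \<open>lik_ratio\<close>, so no product with infinity arises and the factorization of both joint
  densities suffices.\<close>

lemma lik_ratio_append_obs:
  assumes "x \<in> space (data_measure n)" "w \<in> space (data_measure [m])"
    and "0 < joint_density f0 n x" "0 < joint_density f0 [m] w"
  shows "lik_ratio (n @ [m]) (append_obs n m (x, w)) = lik_ratio n x * lik_ratio [m] w"
  using assms joint_density_f1_nonneg[of x n] joint_density_f1_nonneg[of w "[m]"]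
  by (simp add: lik_ratio_def joint_density_append_obs flip: ennreal_mult)

lemma restrict_append_obs:
  assumes "x \<in> space (data_measure n)"
  shows "restrict (append_obs n m (x, w)) (obs_index n) = x"
proof
  fix ij
  show "restrict (append_obs n m (x, w)) (obs_index n) ij = x ij"
  proof (cases "ij \<in> obs_index n")
    case True
    then have "fst ij < length n" by (auto simp: obs_index_def)
    then show ?thesis using True by (simp add: append_obs_def obs_index_append)
  next
    \<comment> \<open>Off the index set both functions are \<open>undefined\<close>, as points of
      the sample space are extensional.\<close>
    case False
    then show ?thesis
      using assms PiE_arb[of x "obs_index n" "\<lambda>_. space M" ij] by (simp add: data_measure_def space_PiM)
  qed
qed

lemma restrict_space_data_measure:
  "x \<in> space (data_measure n) \<Longrightarrow> restrict x (obs_index n) = x"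
  by (simp add: data_measure_def space_PiM)

text \<open>A decision up to stage \<open>length n\<close> reads only groups already present, so the
  adjoined group cannot influence it.\<close>

lemma stop_first_append_obs:
  assumes x: "x \<in> space (data_measure n)" and i: "i \<le> length n"
  shows "stop_first \<psi> (n @ [m]) (append_obs n m (x, w)) i = stop_first \<psi> n x i"
proof -
  have "restrict (append_obs n m (x, w)) (obs_index (take i n))
      = restrict (restrict (append_obs n m (x, w)) (obs_index n)) (obs_index (take i n))"
    using obs_index_take[of i n] by (simp add: Int_absorb1)
  then show ?thesis using i by (simp add: stop_first_def restrict_append_obs[OF x])
qed

lemma stop_first_length:
  "x \<in> space (data_measure n) \<Longrightarrow> stop_first \<psi> n x (length n) = \<psi> n x"
  by (simp add: stop_first_def restrict_space_data_measure)

text \<open>The new group contributes exactly one factor, the decision to continue at stage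
  \<open>length n\<close>. For empty \<open>n\<close> there is no such factor, since nothing is
  decided before the first group.\<close>

lemma reach_append_obs:
  assumes x: "x \<in> space (data_measure n)" and n: "1 \<le> length n"
  shows "reach \<psi> (n @ [m]) (append_obs n m (x, w)) = reach \<psi> n x * (1 - \<psi> n x)"
proof -
  have "{1..<length (n @ [m])} = insert (length n) {1..<length n}" using n by auto
  then show ?thesis
    using x by (simp add: reach_def stop_first_append_obs stop_first_length mult.commute)
qed

section \<open>Expectations under the null density\<close>

text \<open>Tonelli for the image measure under \<open>append_obs\<close>; the density of the old
  groups is constant in the inner integral and can be pulled out of it.\<close>

lemma E0_append:
  assumes [measurable]: "F \<in> borel_measurable (data_measure (n @ [m]))"
  shows "E0 (n @ [m]) F = E0 n (\<lambda>x. E0 [m] (\<lambda>w. F (append_obs n m (x, w))))"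
proof -
  interpret D: sigma_finite_measure "data_measure [m]" by (rule sigma_finite_data_measure)
  have "E0 (n @ [m]) F = (\<integral>\<^sup>+z. F (append_obs n m z) *
      ennreal (joint_density f0 (n @ [m]) (append_obs n m z)) \<partial>(data_measure n \<Otimes>\<^sub>M data_measure [m]))"
    unfolding E0_def by (subst distr_append_obs[symmetric], subst nn_integral_distr) simp_all
  also have "\<dots> = (\<integral>\<^sup>+x. \<integral>\<^sup>+w. F (append_obs n m (x, w)) *
      ennreal (joint_density f0 (n @ [m]) (append_obs n m (x, w))) \<partial>data_measure [m] \<partial>data_measure n)"
    by (subst D.nn_integral_fst[symmetric]) simp_all
  also have "\<dots> = E0 n (\<lambda>x. E0 [m] (\<lambda>w. F (append_obs n m (x, w))))"
    unfolding E0_def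
  proof (rule nn_integral_cong)
    fix x assume x: "x \<in> space (data_measure n)"
    have [measurable]: "(\<lambda>w. append_obs n m (x, w)) \<in> data_measure [m] \<rightarrow>\<^sub>M data_measure (n @ [m])"
      using measurable_compose[OF measurable_Pair1'[OF x] measurable_append_obs] .
    have "(\<integral>\<^sup>+w. F (append_obs n m (x, w)) *
        ennreal (joint_density f0 (n @ [m]) (append_obs n m (x, w))) \<partial>data_measure [m])
      = (\<integral>\<^sup>+w. (F (append_obs n m (x, w)) * ennreal (joint_density f0 [m] w)) *
        ennreal (joint_density f0 n x) \<partial>data_measure [m])"
      using x by (intro nn_integral_cong)
        (simp add: joint_density_append_obs joint_density_f0_nonneg ennreal_mult mult_ac)
    also have "\<dots> = (\<integral>\<^sup>+w. F (append_obs n m (x, w)) * ennreal (joint_density f0 [m] w) \<partial>data_measure [m])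
        * ennreal (joint_density f0 n x)"
      by (rule nn_integral_multc) simp
    finally show "(\<integral>\<^sup>+w. F (append_obs n m (x, w)) *
        ennreal (joint_density f0 (n @ [m]) (append_obs n m (x, w))) \<partial>data_measure [m])
      = (\<integral>\<^sup>+w. F (append_obs n m (x, w)) * ennreal (joint_density f0 [m] w) \<partial>data_measure [m])
        * ennreal (joint_density f0 n x)" .
  qed
  finally show ?thesis .
qed

text \<open>Points of null density zero have weight zero. This removes all points with an infinite
  likelihood ratio from later computations.\<close>

lemma E0_cong:
  "(\<And>x. x \<in> space (data_measure n) \<Longrightarrow> 0 < joint_density f0 n x \<Longrightarrow> F x = H x) \<Longrightarrow> E0 n F = E0 n H"
  unfolding E0_def
  by (rule nn_integral_cong)
    (metis ennreal_0 joint_density_f0_nonneg mult_zero_right order_le_less)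

lemma E0_mono:
  "(\<And>x. x \<in> space (data_measure n) \<Longrightarrow> F x \<le> H x) \<Longrightarrow> E0 n F \<le> E0 n H"
  unfolding E0_def by (intro nn_integral_mono mult_right_mono) auto

lemma E0_add:
  assumes [measurable]: "F \<in> borel_measurable (data_measure n)" "H \<in> borel_measurable (data_measure n)"
  shows "E0 n (\<lambda>x. F x + H x) = E0 n F + E0 n H"
  unfolding E0_def by (simp add: distrib_right nn_integral_add)

lemma E0_cmult:
  assumes [measurable]: "F \<in> borel_measurable (data_measure n)"
  shows "E0 n (\<lambda>x. a * F x) = a * E0 n F"
  unfolding E0_def by (simp add: mult.assoc nn_integral_cmult)

lemma E0_infsum:
  fixes F :: "'b::countable \<Rightarrow> _"
  assumes [measurable]: "\<And>i. i \<in> A \<Longrightarrow> F i \<in> borel_measurable (data_measure n)"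
  shows "infsum (\<lambda>i. E0 n (F i)) A = E0 n (\<lambda>x. infsum (\<lambda>i. F i x) A)"
  unfolding E0_def
  by (subst infsum_ennreal_nn_integral[symmetric])
    (auto simp: infsum_ennreal_cmult mult.commute[of _ "ennreal _"])

text \<open>The density of a single group is a product of \<open>m\<close> probability densities in
  separate coordinates, hence has total mass one, also for the empty group.\<close>

lemma E0_const: "E0 [m] (\<lambda>x. a) = a"
proof -
  have "(\<integral>\<^sup>+x. ennreal (joint_density f0 [m] x) \<partial>data_measure [m])
      = (\<integral>\<^sup>+x. (\<Prod>ij\<in>obs_index [m]. ennreal (f0 (x ij))) \<partial>data_measure [m])"
  proof (rule nn_integral_cong)
    fix x assume x: "x \<in> space (data_measure [m])"
    have "obs_index [m] = Pair 0 ` {..<m}" by (auto simp: obs_index_def)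
    moreover have "0 \<le> f0 (x (0, j))" if "j < m" for j
      using x that by (auto simp: data_measure_def space_PiM PiE_iff obs_index_def intro!: f0_nonneg)
    ultimately show "ennreal (joint_density f0 [m] x) = (\<Prod>ij\<in>obs_index [m]. ennreal (f0 (x ij)))"
      by (subst prod_ennreal) (auto simp: joint_density_def prod.reindex inj_on_def)
  qed
  also have "\<dots> = (\<Prod>ij\<in>obs_index [m]. \<integral>\<^sup>+x. ennreal (f0 x) \<partial>M)"
    unfolding data_measure_def by (rule data.product_nn_integral_prod) auto
  also have "\<dots> = 1" by (simp add: f0_density)
  finally show ?thesis by (simp add: E0_def nn_integral_cmult)
qed

section \<open>Backward induction\<close>

text \<open>The inverse takes \<open>butlast\<close> and \<open>last\<close>. It serves to write a
  sum over lists of length \<open>Suc k\<close> as a double sum over the first \<open>k\<close>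
  sizes and the last one.\<close>

lemma bij_betw_sizes_Suc: "bij_betw (\<lambda>(n, m). n @ [m]) (sizes k \<times> G) (sizes (Suc k))"
  unfolding bij_betw_def
proof
  show "(\<lambda>(n, m). n @ [m]) ` (sizes k \<times> G) = sizes (Suc k)"
  proof (intro equalityI subsetI)
    fix l assume l: "l \<in> sizes (Suc k)"
    then have "l = butlast l @ [last l]" by (intro append_butlast_last_id[symmetric]) (auto simp: sizes_def)
    moreover have "last l \<in> set l" using l by (intro last_in_set) (auto simp: sizes_def)
    then have "butlast l \<in> sizes k" "last l \<in> G"
      using l by (auto simp: sizes_def dest!: in_set_butlastD)
    ultimately show "l \<in> (\<lambda>(n, m). n @ [m]) ` (sizes k \<times> G)"
      by (auto intro!: image_eqI[of _ _ "(butlast l, last l)"])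
  qed (auto simp: sizes_def)
qed (auto simp: inj_on_def)

lemma size_prob_append: "size_prob (n @ [m]) = size_prob n * pmf (p (Suc (length n))) m"
  by (simp add: size_prob_def nth_append)

lemma size_prob_nonneg: "0 \<le> size_prob n"
  by (simp add: size_prob_def prod_nonneg)

lemma total_cost_append: "total_cost (n @ [m]) = total_cost n + c m"
  by (simp add: total_cost_def nth_append)

lemma total_cost_nonneg:
  assumes "n \<in> sizes k"
  shows "0 \<le> total_cost n"
  unfolding total_cost_def
proof (rule sum_nonneg)
  fix i assume "i \<in> {..<length n}"
  then have "n ! i \<in> G" using assms by (auto simp: sizes_def)
  then show "0 \<le> c (n ! i)" using cost_pos by (simp add: less_imp_le)
qed

lemma infsum_pmf:
  assumes "1 \<le> k"
  shows "(\<Sum>\<^sub>\<infinity>m\<in>G. ennreal (pmf (p k) m)) = 1"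
proof -
  have "emeasure (measure_pmf (p k)) G = 1"
    using p_values[OF assms] by (auto intro!: measure_pmf.emeasure_eq_1_AE simp: AE_measure_pmf_iff)
  then show ?thesis by (simp add: infsum_ennreal_eq_nn_integral nn_integral_pmf)
qed

section \<open>Measurability and bounds of the value functions\<close>

lemma measurable_group_mean [measurable]:
  assumes [measurable]: "h \<in> borel_measurable borel"
  shows "group_mean k h \<in> borel_measurable borel"
proof -
  have "(\<lambda>z. E0 [m] (\<lambda>x. h (z * lik_ratio [m] x))) \<in> borel_measurable borel" for m
    unfolding E0_def
    by (intro sigma_finite_measure.borel_measurable_nn_integral[OF sigma_finite_data_measure]) measurable
  then show ?thesis
    unfolding group_mean_def[abs_def] by (intro borel_measurable_infsum_ennreal) measurable
qed

lemma measurable_g [measurable]: "g \<in> borel_measurable borel"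
  unfolding g_def[abs_def] by measurable

lemma V_less: "k < N \<Longrightarrow> V N k z = min (g z) (mean_cost (Suc k) + Vbar N (Suc k) z)"
  by (simp add: V.simps[of N k] Vbar_def)

lemma V_last: "V N N = g"
  by (simp add: V.simps[of N N])

lemma measurable_V [measurable]: "V N k \<in> borel_measurable borel"
proof (induction N k rule: V.induct)
  case (1 N k)
  show ?case
  proof (cases "k < N")
    case True
    then have [measurable]: "V N (Suc k) \<in> borel_measurable borel" using 1 by simp
    show ?thesis using True by (subst V.simps) simp
  next
    case False
    then show ?thesis by (subst V.simps) simp
  qed
qed

lemma measurable_Vbar [measurable]: "Vbar N k \<in> borel_measurable borel"
  unfolding Vbar_def[abs_def] by measurable

lemma V_le: "V N k z \<le> ennreal l0"
  by (cases "k < N") (auto simp: V.simps[of N k] g_def min_le_iff_disj)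

text \<open>The bound \<open>l0\<close> on the stopping loss survives averaging, because the size
  probabilities and the group densities both have total mass one. It keeps every continuation cost
  finite.\<close>

lemma Vbar_le:
  assumes "1 \<le> k"
  shows "Vbar N k z \<le> ennreal l0"
proof -
  have "Vbar N k z \<le> (\<Sum>\<^sub>\<infinity>m\<in>G. ennreal (pmf (p k) m) * E0 [m] (\<lambda>x. ennreal l0))"
    unfolding Vbar_def group_mean_def
    by (intro infsum_ennreal_mono mult_left_mono E0_mono V_le) auto
  also have "\<dots> = ennreal l0"
    using infsum_pmf[OF assms] by (simp add: E0_const mult.commute[of _ "ennreal l0"] infsum_ennreal_cmult)
  finally show ?thesis .
qed

lemma continuation_cost_finite: "1 \<le> k \<Longrightarrow> mean_cost k + Vbar N k z < \<infinity>"
  using mean_cost_finite[of k] Vbar_le[of k N z] by (auto simp: mean_cost_def le_less_trans)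

section \<open>Regularity of stopping and reaching probabilities\<close>

lemma stop_first_stopping_rule:
  assumes "stopping_rule \<psi>" "n \<in> sizes k" "1 \<le> i" "i \<le> k"
  shows "(\<lambda>x. stop_first \<psi> n x i) \<in> borel_measurable (data_measure n)"
    and "x \<in> space (data_measure n) \<Longrightarrow> stop_first \<psi> n x i \<in> {0..1}"
proof -
  have "take i n \<in> sizes i" using assms set_take_subset[of i n] by (auto simp: sizes_def)
  then have *: "\<psi> (take i n) \<in> borel_measurable (data_measure (take i n))"
      "\<And>x. x \<in> space (data_measure (take i n)) \<Longrightarrow> \<psi> (take i n) x \<in> {0..1}"
    using assms unfolding stopping_rule_def by auto
  have r: "(\<lambda>x. restrict x (obs_index (take i n))) \<in> data_measure n \<rightarrow>\<^sub>M data_measure (take i n)"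
    unfolding data_measure_def by (rule measurable_restrict_subset[OF obs_index_take])
  show "(\<lambda>x. stop_first \<psi> n x i) \<in> borel_measurable (data_measure n)"
    unfolding stop_first_def using measurable_compose[OF r *(1)] .
  show "stop_first \<psi> n x i \<in> {0..1}" if "x \<in> space (data_measure n)"
    unfolding stop_first_def using *(2) measurable_space[OF r that] by blast
qed

lemma measurable_reach:
  assumes "stopping_rule \<psi>" "n \<in> sizes k"
  shows "reach \<psi> n \<in> borel_measurable (data_measure n)"
  unfolding reach_def
  using assms
  by (intro borel_measurable_prod borel_measurable_diff borel_measurable_const)
    (auto intro!: stop_first_stopping_rule(1)[of \<psi> n k] simp: sizes_def)

lemma reach_nonneg:
  assumes "stopping_rule \<psi>" "n \<in> sizes k" "x \<in> space (data_measure n)"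
  shows "0 \<le> reach \<psi> n x"
  unfolding reach_def
proof (rule prod_nonneg)
  fix i assume "i \<in> {1..<length n}"
  then show "0 \<le> 1 - stop_first \<psi> n x i"
    using stop_first_stopping_rule(2)[OF assms(1,2) _ _ assms(3), of i] assms(2) by (auto simp: sizes_def)
qed

lemma stopping_ruleD:
  assumes "stopping_rule \<psi>" "n \<in> sizes k" "1 \<le> k"
  shows "\<psi> n \<in> borel_measurable (data_measure n)"
    and "x \<in> space (data_measure n) \<Longrightarrow> 0 \<le> \<psi> n x \<and> \<psi> n x \<le> 1"
  using assms unfolding stopping_rule_def by auto

section \<open>One step of the backward induction\<close>

text \<open>The term of the series \<open>L\<close> with index \<open>k\<close>, that is, the
  contribution of experiments stopped exactly at that stage.\<close>

definition stage_cost :: "(nat list \<Rightarrow> (nat \<times> nat \<Rightarrow> 'a) \<Rightarrow> real) \<Rightarrow> nat \<Rightarrow> ennreal" where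
  "stage_cost \<psi> k = (\<Sum>\<^sub>\<infinity>n\<in>sizes k. ennreal (size_prob n) *
     E0 n (\<lambda>x. ennreal (stop_at \<psi> n x) * (ennreal (total_cost n) + g (lik_ratio n x))))"

text \<open>The weight is \<open>reach\<close> instead of \<open>stop_at\<close>: every experiment
  that gets as far as stage \<open>k\<close> is charged its sampling cost and the value
  \<open>h\<close> in place of the terminal loss.\<close>

definition remaining_cost ::
    "(nat list \<Rightarrow> (nat \<times> nat \<Rightarrow> 'a) \<Rightarrow> real) \<Rightarrow> (ennreal \<Rightarrow> ennreal) \<Rightarrow> nat \<Rightarrow> ennreal" where
  "remaining_cost \<psi> h k = (\<Sum>\<^sub>\<infinity>n\<in>sizes k. ennreal (size_prob n) *
     E0 n (\<lambda>x. ennreal (reach \<psi> n x) * (ennreal (total_cost n) + h (lik_ratio n x))))"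

text \<open>Conditioning on the first \<open>k\<close> groups: the probability of continuing and the
  accumulated cost depend on them alone and leave the inner expectation, while the likelihood ratio
  factors.\<close>

lemma E0_append_group:
  assumes \<psi>: "stopping_rule \<psi>" and n: "n \<in> sizes k" "1 \<le> k" and m: "m \<in> G"
    and h [measurable]: "h \<in> borel_measurable borel"
  shows "E0 (n @ [m]) (\<lambda>x. ennreal (reach \<psi> (n @ [m]) x) *
      (ennreal (total_cost (n @ [m])) + h (lik_ratio (n @ [m]) x)))
    = E0 n (\<lambda>x. ennreal (reach \<psi> n x * (1 - \<psi> n x)) * (ennreal (total_cost n) +
      (ennreal (c m) + E0 [m] (\<lambda>w. h (lik_ratio n x * lik_ratio [m] w)))))"
proof -
  have nm: "n @ [m] \<in> sizes (Suc k)" using n m by (auto simp: sizes_def)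
  note [measurable] = measurable_reach[OF \<psi> nm]
  have len: "1 \<le> length n" using n by (simp add: sizes_def)
  have cost: "ennreal (total_cost (n @ [m])) = ennreal (total_cost n) + ennreal (c m)"
    using total_cost_nonneg[OF n(1)] cost_pos[OF m] by (simp add: total_cost_append)
  show ?thesis
    unfolding cost
  proof (subst E0_append, measurable, rule E0_cong)
    fix x assume x: "x \<in> space (data_measure n)" "0 < joint_density f0 n x"
    let ?A = "ennreal (reach \<psi> n x * (1 - \<psi> n x))"
    have "E0 [m] (\<lambda>w. ennreal (reach \<psi> (n @ [m]) (append_obs n m (x, w))) *
          (ennreal (total_cost n) + ennreal (c m) + h (lik_ratio (n @ [m]) (append_obs n m (x, w)))))
        = E0 [m] (\<lambda>w. ?A * (ennreal (total_cost n) + ennreal (c m) + h (lik_ratio n x * lik_ratio [m] w)))"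
      using x by (intro E0_cong) (simp add: reach_append_obs[OF _ len] lik_ratio_append_obs)
    also have "\<dots> = ?A * (ennreal (total_cost n) + ennreal (c m) + E0 [m] (\<lambda>w. h (lik_ratio n x * lik_ratio [m] w)))"
      by (simp add: E0_cmult E0_add E0_const)
    finally show "E0 [m] (\<lambda>w. ennreal (reach \<psi> (n @ [m]) (append_obs n m (x, w))) *
          (ennreal (total_cost n) + ennreal (c m) + h (lik_ratio (n @ [m]) (append_obs n m (x, w)))))
        = ?A * (ennreal (total_cost n) + (ennreal (c m) + E0 [m] (\<lambda>w. h (lik_ratio n x * lik_ratio [m] w))))"
      by (simp add: add.assoc)
  qed
qed

lemma measurable_E0_lik_ratio:
  assumes [measurable]: "h \<in> borel_measurable borel"
  shows "(\<lambda>x. E0 [m] (\<lambda>w. h (lik_ratio n x * lik_ratio [m] w))) \<in> borel_measurable (data_measure n)"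
  unfolding E0_def
  by (intro sigma_finite_measure.borel_measurable_nn_integral[OF sigma_finite_data_measure]) measurable

text \<open>Averaging over the size of group \<open>Suc k\<close> turns its cost into
  \<open>mean_cost\<close> and the inner expectations into \<open>group_mean\<close>. The result is
  again a sum over lists of length \<open>k\<close>, comparable term by term with quantities of
  stage \<open>k\<close>.\<close>

lemma remaining_cost_Suc:
  assumes \<psi>: "stopping_rule \<psi>" and k: "1 \<le> k" and h [measurable]: "h \<in> borel_measurable borel"
  shows "remaining_cost \<psi> h (Suc k) = (\<Sum>\<^sub>\<infinity>n\<in>sizes k. ennreal (size_prob n) *
    E0 n (\<lambda>x. ennreal (reach \<psi> n x * (1 - \<psi> n x)) * (ennreal (total_cost n) +
      (mean_cost (Suc k) + group_mean (Suc k) h (lik_ratio n x)))))"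
proof -
  let ?A = "\<lambda>n x. ennreal (reach \<psi> n x * (1 - \<psi> n x))"
  let ?e = "\<lambda>n m x. E0 [m] (\<lambda>w. h (lik_ratio n x * lik_ratio [m] w))"
  let ?p = "\<lambda>m. ennreal (pmf (p (Suc k)) m)"
  let ?R = "\<lambda>n. ennreal (size_prob n) * E0 n (\<lambda>x. ennreal (reach \<psi> n x) *
      (ennreal (total_cost n) + h (lik_ratio n x)))"
  have "remaining_cost \<psi> h (Suc k) = (\<Sum>\<^sub>\<infinity>(n, m)\<in>sizes k \<times> G. ?R (n @ [m]))"
    unfolding remaining_cost_def
    by (subst infsum_reindex_bij_betw[OF bij_betw_sizes_Suc[of k], symmetric]) (simp add: split_beta')
  also have "\<dots> = (\<Sum>\<^sub>\<infinity>n\<in>sizes k. \<Sum>\<^sub>\<infinity>m\<in>G. ?R (n @ [m]))"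
    by (rule infsum_ennreal_Sigma[symmetric])
  also have "\<dots> = (\<Sum>\<^sub>\<infinity>n\<in>sizes k. ennreal (size_prob n) *
    E0 n (\<lambda>x. ?A n x * (ennreal (total_cost n) +
      (mean_cost (Suc k) + group_mean (Suc k) h (lik_ratio n x)))))"
  proof (rule infsum_cong)
    fix n assume n: "n \<in> sizes k"
    note [measurable] = measurable_reach[OF \<psi> n] stopping_ruleD(1)[OF \<psi> n k] measurable_E0_lik_ratio
    let ?C = "ennreal (total_cost n)"
    have "(\<Sum>\<^sub>\<infinity>m\<in>G. ?R (n @ [m]))
        = (\<Sum>\<^sub>\<infinity>m\<in>G. ennreal (size_prob n) * E0 n (\<lambda>x. ?p m * (?A n x * (?C + (ennreal (c m) + ?e n m x)))))"
      using n by (intro infsum_cong)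
        (simp add: E0_append_group[OF \<psi> n k _ h] E0_cmult size_prob_append ennreal_mult size_prob_nonneg
          sizes_def mult.assoc)
    also have "\<dots> = ennreal (size_prob n) *
        E0 n (\<lambda>x. \<Sum>\<^sub>\<infinity>m\<in>G. ?p m * (?A n x * (?C + (ennreal (c m) + ?e n m x))))"
      by (simp add: infsum_ennreal_cmult E0_infsum)
    also have "(\<lambda>x. \<Sum>\<^sub>\<infinity>m\<in>G. ?p m * (?A n x * (?C + (ennreal (c m) + ?e n m x))))
        = (\<lambda>x. ?A n x * (?C + (mean_cost (Suc k) + group_mean (Suc k) h (lik_ratio n x))))"
    proof
      fix x
      have "(\<Sum>\<^sub>\<infinity>m\<in>G. ?p m * (?A n x * (?C + (ennreal (c m) + ?e n m x))))
          = (\<Sum>\<^sub>\<infinity>m\<in>G. ?A n x * (?C * ?p m + (?p m * ennreal (c m) + ?p m * ?e n m x)))"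
        by (simp add: distrib_left mult_ac)
      also have "\<dots> = ?A n x * (?C * (\<Sum>\<^sub>\<infinity>m\<in>G. ?p m) +
          (mean_cost (Suc k) + group_mean (Suc k) h (lik_ratio n x)))"
        by (simp add: infsum_ennreal_cmult infsum_ennreal_add mean_cost_def group_mean_def)
      \<comment> \<open>The cost already paid is multiplied by the total mass of the size
        distribution, which is one.\<close>
      finally show "(\<Sum>\<^sub>\<infinity>m\<in>G. ?p m * (?A n x * (?C + (ennreal (c m) + ?e n m x))))
          = ?A n x * (?C + (mean_cost (Suc k) + group_mean (Suc k) h (lik_ratio n x)))"
        by (simp add: infsum_pmf)
    qed
    finally show "(\<Sum>\<^sub>\<infinity>m\<in>G. ?R (n @ [m])) = ennreal (size_prob n) *
        E0 n (\<lambda>x. ?A n x * (?C + (mean_cost (Suc k) + group_mean (Suc k) h (lik_ratio n x))))" .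
  qed
  finally show ?thesis .
qed

text \<open>The equality case of monotone integration, with the density factor cancelled; this is
  where almost sure statements under the null density come from.\<close>

lemma E0_mono_eq_iff:
  assumes [measurable]: "F \<in> borel_measurable (data_measure n)" "H \<in> borel_measurable (data_measure n)"
    and le: "\<And>x. x \<in> space (data_measure n) \<Longrightarrow> F x \<le> H x" and fin: "E0 n F \<noteq> \<infinity>"
  shows "E0 n F = E0 n H \<longleftrightarrow> (AE x in data_measure n. 0 < joint_density f0 n x \<longrightarrow> F x = H x)"
proof -
  have "E0 n F = E0 n H \<longleftrightarrow> (AE x in data_measure n.
      F x * ennreal (joint_density f0 n x) = H x * ennreal (joint_density f0 n x))"
    unfolding E0_def
    using fin by (intro nn_integral_mono_eq_iff) (auto simp: E0_def intro!: mult_right_mono le)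
  also have "\<dots> \<longleftrightarrow> (AE x in data_measure n. 0 < joint_density f0 n x \<longrightarrow> F x = H x)"
  proof (rule AE_cong)
    fix x assume "x \<in> space (data_measure n)"
    then have "0 \<le> joint_density f0 n x" by (rule joint_density_f0_nonneg)
    \<comment> \<open>The density value is a finite number: it cancels where positive and makes both
      sides zero elsewhere.\<close>
    then show "F x * ennreal (joint_density f0 n x) = H x * ennreal (joint_density f0 n x)
        \<longleftrightarrow> (0 < joint_density f0 n x \<longrightarrow> F x = H x)"
      by (auto simp: mult.commute[of _ "ennreal _"] ennreal_mult_cancel_left)
  qed
  finally show ?thesis .
qed

text \<open>Both sides become sums over the same size lists, with integrands compared pointwise by
  \<open>mixture_ge_min\<close>. Equality then descends from the sum to its terms, from terms to
  expectations, and from expectations to almost every point, where it is the optimality condition of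
  stage \<open>k\<close>.\<close>

lemma remaining_cost_step:
  assumes \<psi>: "stopping_rule \<psi>" and k: "1 \<le> k" "k < N"
  shows "remaining_cost \<psi> (V N k) k \<le> stage_cost \<psi> k + remaining_cost \<psi> (V N (Suc k)) (Suc k)"
    and "remaining_cost \<psi> (V N k) k \<noteq> \<infinity> \<Longrightarrow>
      remaining_cost \<psi> (V N k) k = stage_cost \<psi> k + remaining_cost \<psi> (V N (Suc k)) (Suc k) \<longleftrightarrow>
      (\<forall>n\<in>pos_sizes k. AE x in data_measure n. x \<in> reach_set \<psi> n \<and> 0 < joint_density f0 n x \<longrightarrow>
          approx_indicator (\<psi> n x) (g (lik_ratio n x))
            (mean_cost (Suc k) + Vbar N (Suc k) (lik_ratio n x)))"
proof -
  let ?b = "\<lambda>n x. mean_cost (Suc k) + Vbar N (Suc k) (lik_ratio n x)"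
  let ?C = "\<lambda>n. ennreal (total_cost n)"
  let ?F = "\<lambda>n x. ennreal (reach \<psi> n x) * (?C n + V N k (lik_ratio n x))"
  \<comment> \<open>The randomized decision at stage \<open>k\<close>: stop and pay
    \<open>g\<close>, or continue and pay the expected optimal cost from the next group on.\<close>
  let ?H = "\<lambda>n x. ennreal (stop_at \<psi> n x) * (?C n + g (lik_ratio n x))
    + ennreal (reach \<psi> n x * (1 - \<psi> n x)) * (?C n + ?b n x)"
  let ?opt = "\<lambda>n x. approx_indicator (\<psi> n x) (g (lik_ratio n x)) (?b n x)"
  have meas [measurable]: "reach \<psi> n \<in> borel_measurable (data_measure n)"
      "\<psi> n \<in> borel_measurable (data_measure n)" if "n \<in> sizes k" for n
    using measurable_reach[OF \<psi> that] stopping_ruleD(1)[OF \<psi> that k(1)] by auto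
  have measF: "?F n \<in> borel_measurable (data_measure n)" if [simp]: "n \<in> sizes k" for n
    by measurable
  have measH: "?H n \<in> borel_measurable (data_measure n)" if [simp]: "n \<in> sizes k" for n
    unfolding stop_at_def by measurable
  have sum_eq: "stage_cost \<psi> k + remaining_cost \<psi> (V N (Suc k)) (Suc k)
      = (\<Sum>\<^sub>\<infinity>n\<in>sizes k. ennreal (size_prob n) * E0 n (?H n))"
    unfolding stage_cost_def remaining_cost_Suc[OF \<psi> k(1) measurable_V]
      infsum_ennreal_add[symmetric] Vbar_def[symmetric]
  proof (rule infsum_cong)
    fix n assume [simp]: "n \<in> sizes k"
    show "ennreal (size_prob n) * E0 n (\<lambda>x. ennreal (stop_at \<psi> n x) * (?C n + g (lik_ratio n x)))
        + ennreal (size_prob n) * E0 n (\<lambda>x. ennreal (reach \<psi> n x * (1 - \<psi> n x)) * (?C n + ?b n x))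
        = ennreal (size_prob n) * E0 n (?H n)"
      by (subst E0_add) (simp_all add: distrib_left stop_at_def[abs_def])
  qed
  have V: "V N k z = min (g z) (mean_cost (Suc k) + Vbar N (Suc k) z)" for z
    using k by (rule_tac V_less)
  have g_fin: "g z < \<infinity>" for z
    by (simp add: g_def min_less_iff_disj)
  have b_fin: "?b n x < \<infinity>" for n x
    by (rule continuation_cost_finite) simp
  have le: "?F n x \<le> ?H n x"
    and eq: "?F n x = ?H n x \<longleftrightarrow> (x \<in> reach_set \<psi> n \<longrightarrow> ?opt n x)"
    if n: "n \<in> sizes k" and x: "x \<in> space (data_measure n)" for n x
  proof -
    note hyps = total_cost_nonneg[OF n] reach_nonneg[OF \<psi> n x]
      conjunct1[OF stopping_ruleD(2)[OF \<psi> n k(1) x]] conjunct2[OF stopping_ruleD(2)[OF \<psi> n k(1) x]]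
      g_fin[of "lik_ratio n x"] b_fin[of n x]
    show "?F n x \<le> ?H n x"
      unfolding V stop_at_def by (rule mixture_ge_min(1)[OF hyps])
    \<comment> \<open>The alternative \<open>r = 0\<close> in the equality case is exactly the
      complement of \<open>reach_set\<close>.\<close>
    have "x \<in> reach_set \<psi> n \<longleftrightarrow> reach \<psi> n x \<noteq> 0"
      using x hyps(2) by (auto simp: reach_set_def)
    then show "?F n x = ?H n x \<longleftrightarrow> (x \<in> reach_set \<psi> n \<longrightarrow> ?opt n x)"
      unfolding V stop_at_def mixture_ge_min(2)[OF hyps] approx_indicator_def by auto
  qed
  have term_le: "ennreal (size_prob n) * E0 n (?F n) \<le> ennreal (size_prob n) * E0 n (?H n)"
    if "n \<in> sizes k" for n
    using le[OF that] by (intro mult_left_mono E0_mono) auto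
  then show "remaining_cost \<psi> (V N k) k \<le> stage_cost \<psi> k + remaining_cost \<psi> (V N (Suc k)) (Suc k)"
    unfolding sum_eq unfolding remaining_cost_def by (rule infsum_ennreal_mono)
  assume fin: "remaining_cost \<psi> (V N k) k \<noteq> \<infinity>"
  have "remaining_cost \<psi> (V N k) k = stage_cost \<psi> k + remaining_cost \<psi> (V N (Suc k)) (Suc k) \<longleftrightarrow>
      (\<forall>n\<in>sizes k. ennreal (size_prob n) * E0 n (?F n) = ennreal (size_prob n) * E0 n (?H n))"
    unfolding sum_eq using fin unfolding remaining_cost_def
    by (intro infsum_ennreal_mono_eq_iff term_le)
  also have "\<dots> \<longleftrightarrow> (\<forall>n\<in>pos_sizes k. E0 n (?F n) = E0 n (?H n))"
  proof -
    \<comment> \<open>Size lists of probability zero impose nothing, which is why only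
      \<open>pos_sizes\<close> remains.\<close>
    have scale: "ennreal s * a = ennreal s * b \<longleftrightarrow> (0 < s \<longrightarrow> a = b)" for s a b
      by (simp add: ennreal_mult_cancel_left ennreal_eq_0_iff not_less[symmetric])
    show ?thesis unfolding scale pos_sizes_def by blast
  qed
  also have "\<dots> \<longleftrightarrow> (\<forall>n\<in>pos_sizes k. AE x in data_measure n.
      x \<in> reach_set \<psi> n \<and> 0 < joint_density f0 n x \<longrightarrow> ?opt n x)"
  proof (rule ball_cong[OF refl])
    fix n assume "n \<in> pos_sizes k"
    then have n: "n \<in> sizes k" and pos: "0 < size_prob n" by (auto simp: pos_sizes_def)
    \<comment> \<open>A single term is bounded by the finite total, and its positive weight
      transfers finiteness to the expectation.\<close>
    have "ennreal (size_prob n) * E0 n (?F n) \<le> remaining_cost \<psi> (V N k) k"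
      unfolding remaining_cost_def using n by (rule le_infsum_ennreal)
    with fin pos have "E0 n (?F n) \<noteq> \<infinity>"
      by (auto simp: ennreal_mult_eq_top_iff top_unique)
    then have "E0 n (?F n) = E0 n (?H n) \<longleftrightarrow>
        (AE x in data_measure n. 0 < joint_density f0 n x \<longrightarrow> ?F n x = ?H n x)"
      using n by (intro E0_mono_eq_iff measF measH le)
    also have "\<dots> \<longleftrightarrow> (AE x in data_measure n.
        x \<in> reach_set \<psi> n \<and> 0 < joint_density f0 n x \<longrightarrow> ?opt n x)"
      using eq[OF n] by (intro AE_cong) auto
    finally show "E0 n (?F n) = E0 n (?H n) \<longleftrightarrow> (AE x in data_measure n.
        x \<in> reach_set \<psi> n \<and> 0 < joint_density f0 n x \<longrightarrow> ?opt n x)" .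
  qed
  finally show "remaining_cost \<psi> (V N k) k = stage_cost \<psi> k + remaining_cost \<psi> (V N (Suc k)) (Suc k) \<longleftrightarrow>
      (\<forall>n\<in>pos_sizes k. AE x in data_measure n.
        x \<in> reach_set \<psi> n \<and> 0 < joint_density f0 n x \<longrightarrow> ?opt n x)" .
qed

text \<open>No decision precedes the first group, so \<open>reach\<close> is an empty product, and
  the likelihood ratio starts from 1. This evaluates the lower end of the chain, free of
  \<open>\<psi>\<close>.\<close>

lemma remaining_cost_1:
  assumes h [measurable]: "h \<in> borel_measurable borel"
  shows "remaining_cost \<psi> h 1 = mean_cost 1 + group_mean 1 h 1"
proof -
  have bij: "bij_betw (\<lambda>m. [m]) G (sizes 1)"
    by (auto simp: bij_betw_def inj_on_def sizes_def length_Suc_conv)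
  have "remaining_cost \<psi> h 1 = (\<Sum>\<^sub>\<infinity>m\<in>G. ennreal (pmf (p 1) m) *
      E0 [m] (\<lambda>x. ennreal (c m) + h (lik_ratio [m] x)))"
    unfolding remaining_cost_def
    by (subst infsum_reindex_bij_betw[OF bij, symmetric])
      (simp add: size_prob_def total_cost_def reach_def)
  also have "\<dots> = (\<Sum>\<^sub>\<infinity>m\<in>G. ennreal (pmf (p 1) m) * ennreal (c m)
      + ennreal (pmf (p 1) m) * E0 [m] (\<lambda>x. h (1 * lik_ratio [m] x)))"
    by (simp add: E0_add E0_const distrib_left)
  finally show ?thesis
    by (simp add: infsum_ennreal_add mean_cost_def group_mean_def)
qed

section \<open>Effect of truncation\<close>

text \<open>The truncation product is \<open>reach\<close> times \<open>1 - \<psi> n x\<close>; its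
  vanishing means that either stage \<open>N\<close> is not reached or stopping there is
  certain.\<close>

lemma truncated_rules_last:
  assumes \<psi>: "\<psi> \<in> truncated_rules N" and N: "1 \<le> N" and n: "n \<in> sizes N"
    and x: "x \<in> space (data_measure n)"
  shows "stop_at \<psi> n x = reach \<psi> n x"
proof -
  have len: "length n = N" using n by (simp add: sizes_def)
  have "{1..N} = insert N {1..<N}" using N by auto
  then have "(1 - \<psi> n x) * reach \<psi> n x = (\<Prod>i\<in>{1..N}. 1 - stop_first \<psi> n x i)"
    using stop_first_length[OF x, of \<psi>] by (simp add: reach_def len)
  also have "\<dots> = 0" using \<psi> n x by (simp add: truncated_rules_def)
  finally show ?thesis by (auto simp: stop_at_def)
qed

lemma truncated_rules_reach:
  assumes \<psi>: "\<psi> \<in> truncated_rules N" and n: "n \<in> sizes k" "N < k"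
    and x: "x \<in> space (data_measure n)"
  shows "reach \<psi> n x = 0"
proof -
  let ?x = "restrict x (obs_index (take N n))"
  have "?x \<in> space (data_measure (take N n))"
    using x obs_index_take[of N n] by (auto simp: data_measure_def space_PiM PiE_iff)
  moreover have "take N n \<in> sizes N"
    using n set_take_subset[of N n] by (auto simp: sizes_def)
  ultimately have "(\<Prod>i\<in>{1..N}. 1 - stop_first \<psi> (take N n) ?x i) = 0"
    using \<psi> by (simp add: truncated_rules_def)
  \<comment> \<open>Cutting the sample to its first \<open>N\<close> groups does not change what a
    decision at stage \<open>i \<le> N\<close> reads.\<close>
  moreover have "stop_first \<psi> (take N n) ?x i = stop_first \<psi> n x i" if "i \<in> {1..N}" for i
  proof -
    have "obs_index (take i n) \<subseteq> obs_index (take N n)"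
      using obs_index_take[of i "take N n"] that by (simp add: min_absorb1)
    then show ?thesis using that by (simp add: stop_first_def min_absorb1 Int_absorb1)
  qed
  \<comment> \<open>A finite product that vanishes has a vanishing factor, and
    \<open>i \<le> N < k\<close> places this factor in the product defining
    \<open>reach\<close>.\<close>
  ultimately obtain i where "i \<in> {1..N}" "1 - stop_first \<psi> n x i = 0" by auto
  then show ?thesis
    using n unfolding reach_def by (intro prod_zero) (auto simp: sizes_def intro!: bexI[of _ i])
qed

text \<open>Stages beyond \<open>N\<close> are never reached, and at stage \<open>N\<close> stopping
  is forced, so the last term carries the weight \<open>reach\<close> with terminal loss
  \<open>g = V N N\<close>.\<close>

lemma L_eq:
  assumes \<psi>: "\<psi> \<in> truncated_rules N" and N: "1 \<le> N"
  shows "L \<psi> = (\<Sum>j\<in>{1..<N}. stage_cost \<psi> j) + remaining_cost \<psi> (V N N) N"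
proof -
  have zero: "stage_cost \<psi> k = 0" if "N < k" for k
  proof -
    have "E0 n (\<lambda>x. ennreal (stop_at \<psi> n x) * (ennreal (total_cost n) + g (lik_ratio n x)))
        = E0 n (\<lambda>x. 0)" if "n \<in> sizes k" for n
      using truncated_rules_reach[OF \<psi> that \<open>N < k\<close>] by (intro E0_cong) (simp add: stop_at_def)
    then show ?thesis
      unfolding stage_cost_def by (simp add: E0_def cong: infsum_cong)
  qed
  have "L \<psi> = infsum (stage_cost \<psi>) {1..}"
    by (simp add: L_def stage_cost_def[abs_def])
  also have "\<dots> = infsum (stage_cost \<psi>) {1..N}"
    by (rule infsum_cong_neutral) (auto intro: zero)
  also have "\<dots> = (\<Sum>j\<in>{1..N}. stage_cost \<psi> j)" by simp
  also have "{1..N} = insert N {1..<N}" using N by auto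
  finally have "L \<psi> = (\<Sum>j\<in>{1..<N}. stage_cost \<psi> j) + stage_cost \<psi> N"
    by (simp add: add.commute)
  moreover have "stage_cost \<psi> N = remaining_cost \<psi> g N"
    unfolding stage_cost_def remaining_cost_def
    by (intro infsum_cong arg_cong2[of _ _ _ _ "(*)"] E0_cong refl)
      (simp add: truncated_rules_last[OF \<psi> N])
  ultimately show ?thesis by (simp add: V_last)
qed

section \<open>Chain of inequalities and the equality case\<close>

lemma optimal_truncated:
  assumes \<psi>: "\<psi> \<in> truncated_rules N" and N: "1 \<le> N"
  shows "mean_cost 1 + Vbar N 1 1 \<le> L \<psi>"
    and "optimality_cond N \<psi> \<longleftrightarrow> L \<psi> = mean_cost 1 + Vbar N 1 1"
proof -
  have sr: "stopping_rule \<psi>" using \<psi> by (simp add: truncated_rules_def)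
  \<comment> \<open>\<open>Q k\<close> is the cost of following \<open>\<psi>\<close> before stage \<open>k\<close> and deciding optimally from then on.\<close>
  define Q where "Q k = (\<Sum>j\<in>{1..<k}. stage_cost \<psi> j) + remaining_cost \<psi> (V N k) k" for k
  have Q1: "Q 1 = mean_cost 1 + Vbar N 1 1"
    using remaining_cost_1[OF measurable_V] by (simp add: Q_def Vbar_def)
  have QN: "Q N = L \<psi>" by (simp add: Q_def L_eq[OF \<psi> N])
  have Q_Suc: "Q (Suc k) = (\<Sum>j\<in>{1..<k}. stage_cost \<psi> j) +
      (stage_cost \<psi> k + remaining_cost \<psi> (V N (Suc k)) (Suc k))" if "1 \<le> k" for k
    using that by (simp add: Q_def add.assoc)
  have step: "Q k \<le> Q (Suc k)" if "1 \<le> k" "k < N" for k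
    unfolding Q_Suc[OF that(1)] using remaining_cost_step(1)[OF sr that]
    by (simp add: Q_def add_left_mono)
  have mono: "Q j \<le> Q k" if "1 \<le> j" "j \<le> k" "k \<le> N" for j k
    using that(2,3) by (induction rule: dec_induct) (use step that(1) in \<open>auto intro: order_trans\<close>)
  show "mean_cost 1 + Vbar N 1 1 \<le> L \<psi>"
    using mono[of 1 N] N unfolding Q1 QN by simp
  \<comment> \<open>Finiteness of the lower bound is what makes the equality analysis
    meaningful.\<close>
  have Q1_fin: "Q 1 \<noteq> \<infinity>" using continuation_cost_finite[of 1 N 1] unfolding Q1 by (simp add: less_top)
  let ?opt = "\<lambda>k. \<forall>n\<in>pos_sizes k.
    AE x in data_measure n. x \<in> reach_set \<psi> n \<and> 0 < joint_density f0 n x \<longrightarrow>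
      approx_indicator (\<psi> n x) (g (lik_ratio n x)) (mean_cost (Suc k) + Vbar N (Suc k) (lik_ratio n x))"
  \<comment> \<open>The premise \<open>Q k = Q 1\<close> supplies finiteness of \<open>Q k\<close>,
    which allows the common sum of earlier stage costs to be cancelled and the equality part of the
    one-step lemma to be used.\<close>
  have opt_iff: "?opt k \<longleftrightarrow> Q k = Q (Suc k)" if "1 \<le> k" "k < N" "Q k = Q 1" for k
  proof -
    have "Q k \<noteq> \<infinity>" using that Q1_fin by simp
    then have "(\<Sum>j\<in>{1..<k}. stage_cost \<psi> j) \<noteq> \<infinity>" "remaining_cost \<psi> (V N k) k \<noteq> \<infinity>"
      by (auto simp: Q_def)
    then show ?thesis
      unfolding Q_Suc[OF that(1)] using remaining_cost_step(2)[OF sr that(1,2)]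
      by (simp add: Q_def ennreal_add_left_cancel)
  qed
  show "optimality_cond N \<psi> \<longleftrightarrow> L \<psi> = mean_cost 1 + Vbar N 1 1"
  proof
    assume opt: "optimality_cond N \<psi>"
    \<comment> \<open>Equality is carried upward from stage 1: the induction hypothesis gives the
      premise of \<open>opt_iff\<close>, and optimality at stage \<open>k\<close> then extends it to
      the next stage.\<close>
    have "Q k = Q 1" if "1 \<le> k" "k \<le> N" for k
      using that
    proof (induction rule: dec_induct)
      case (step k)
      then have "?opt k" using opt by (simp add: optimality_cond_def)
      then show ?case using opt_iff[of k] step by simp
    qed simp
    from this[OF N order_refl] show "L \<psi> = mean_cost 1 + Vbar N 1 1" by (simp only: Q1 QN)
  next
    assume "L \<psi> = mean_cost 1 + Vbar N 1 1"
    then have "Q N = Q 1" by (simp only: Q1 QN)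
    \<comment> \<open>Every \<open>Q k\<close> is squeezed between the equal ends of the monotone
      chain, so each single step is an equality.\<close>
    then have Q: "Q k = Q 1" if "1 \<le> k" "k \<le> N" for k
      using mono[of 1 k] mono[of k N] that by (intro antisym) auto
    have "?opt k" if k: "1 \<le> k" "k < N" for k
      using opt_iff[OF k] Q[of k] Q[of "Suc k"] k by (simp only: Suc_leI le_SucI less_imp_le)
    then show "optimality_cond N \<psi>"
      unfolding optimality_cond_def by blast
  qed
qed

end

theorem theorem4p1:
  fixes G :: "nat set"
    and p :: "nat \<Rightarrow> nat pmf"
    and c :: "nat \<Rightarrow> real"
    and M :: "'a measure"
    and f0 f1 :: "'a \<Rightarrow> real"
    and l0 l1 :: real
    and N :: nat
  assumes "grouped_test G p c M f0 f1 l0 l1"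
    and "1 \<le> N"
  shows "\<forall>\<psi>\<in>grouped_test.truncated_rules G M N.
    grouped_test.mean_cost G p c 1 + grouped_test.Vbar G p c M f0 f1 l0 l1 N 1 1
        \<le> grouped_test.L G p c M f0 f1 l0 l1 \<psi> \<and>
    (grouped_test.optimality_cond G p c M f0 f1 l0 l1 N \<psi> \<longrightarrow>
      grouped_test.L G p c M f0 f1 l0 l1 \<psi>
        = grouped_test.mean_cost G p c 1 + grouped_test.Vbar G p c M f0 f1 l0 l1 N 1 1) \<and>
    (grouped_test.L G p c M f0 f1 l0 l1 \<psi>
        = grouped_test.mean_cost G p c 1 + grouped_test.Vbar G p c M f0 f1 l0 l1 N 1 1 \<longrightarrow>
      grouped_test.optimality_cond G p c M f0 f1 l0 l1 N \<psi>)"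
proof -
  interpret grouped_test G p c M f0 f1 l0 l1 by fact
  show ?thesis
    using optimal_truncated[OF _ assms(2)] by blast
qed

end
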